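(* Let $n\ge 3$ be an integer and let $D_{2n}=\langle a,b : a^n=b^2=1,\ bab^{-1}=a^{-1}\rangle$ be the dihedral group. Then \[ \mathrm{CSCom}(D_{2n})\cong\begin{cases}K_1\vee(K_{n-1}\sqcup K_n), & \text{if } n \text{ is odd},\\ K_2\vee(K_{n-2}\sqcup 2K_{n/2}), & \text{if } n \text{ and } \tfrac n2 \text{ are even},\\ K_2\vee(K_{n-2}\sqcup K_n), & \text{if } n \text{ is even and } \tfrac n2 \text{ is odd}.\end{cases} \]
   Context: For a finite group $G$, the conjugacy super commuting graph $\mathrm{CSCom}(G)$ is the simple graph with vertex set $G$ in which two distinct vertices $g,h$ are adjacent if and only if either $g$ and $h$ are conjugate in $G$, or there exist $g'$ in the conjugacy class of $g$ and $h'$ in the conjugacy class of $h$ with $g'h'=h'g'$. $K_r$ is the complete graph on $r$ vertices, $\sqcup$ is disjoint union of graphs, $mK_r$ is the disjoint union of $m$ copies of $K_r$, and $\vee$ is the join of graphs (disjoint union together with all edges between the two vertex sets). *)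

theory Defs
  imports
    "HOL-Algebra.Group"
    "Graph_Theory.Digraph_Isomorphism"
    "Graph_Theory.Kuratowski"
begin

section \<open>Groups given by generators and relations\<close>

text \<open>A letter \<open>(x, True)\<close> stands for the generator \<open>x\<close>, and \<open>(x, False)\<close> for its formal
  inverse. Every element of the type of generators is a generator.\<close>

type_synonym 'g group_word = "('g \<times> bool) list"

text \<open>The congruence on words generated by free cancellation and by the relations \<open>l = r\<close>
  with \<open>(l, r) \<in> R\<close>.\<close>

inductive_set word_cong :: "('g group_word \<times> 'g group_word) set \<Rightarrow> ('g group_word \<times> 'g group_word) set"
  for R where
    refl:   "(u, u) \<in> word_cong R"
  | sym:    "(u, v) \<in> word_cong R \<Longrightarrow> (v, u) \<in> word_cong R"
  | trans:  "(u, v) \<in> word_cong R \<Longrightarrow> (v, w) \<in> word_cong R \<Longrightarrow> (u, w) \<in> word_cong R"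
  | cancel: "(u @ [(x, s), (x, \<not> s)] @ v, u @ v) \<in> word_cong R"
  | rel:    "(l, r) \<in> R \<Longrightarrow> (u @ l @ v, u @ r @ v) \<in> word_cong R"

definition presented_group :: "('g group_word \<times> 'g group_word) set \<Rightarrow> 'g group_word set monoid" where
  "presented_group R =
    \<lparr> carrier = UNIV // word_cong R,
      monoid.mult = (\<lambda>X Y. \<Union>x\<in>X. \<Union>y\<in>Y. word_cong R `` {x @ y}),
      one = word_cong R `` {[]} \<rparr>"

lemma equiv_word_cong: "equiv UNIV (word_cong R)"
  by (intro equivI refl_onI symI transI) (auto intro: word_cong.intros)

lemma word_cong_context:
  "(u, v) \<in> word_cong R \<Longrightarrow> (p @ u @ q, p @ v @ q) \<in> word_cong R"
proof (induction rule: word_cong.induct)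
  case (cancel u x s v)
  show ?case using word_cong.cancel[of "p @ u" x s "v @ q" R] by simp
next
  case (rel l r u v)
  then show ?case using word_cong.rel[of l r R "p @ u" "v @ q"] by simp
qed (auto intro: word_cong.intros)

lemma word_cong_append:
  assumes "(u, u') \<in> word_cong R" "(v, v') \<in> word_cong R"
  shows "(u @ v, u' @ v') \<in> word_cong R"
  using word_cong_context[OF assms(1), of "[]" v] word_cong_context[OF assms(2), of u' "[]"]
  by (auto intro: word_cong.trans)

lemma presented_group_mult:
  "(word_cong R `` {u}) \<otimes>\<^bsub>presented_group R\<^esub> (word_cong R `` {v}) = word_cong R `` {u @ v}"
proof -
  have "congruent2 (word_cong R) (word_cong R) (\<lambda>x y. word_cong R `` {x @ y})"
    unfolding congruent2_def
    by (auto intro!: equiv_class_eq[OF equiv_word_cong] word_cong_append)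
  then show ?thesis
    unfolding presented_group_def
    by (simp add: UN_equiv_class2[OF equiv_word_cong equiv_word_cong])
qed

lemma word_cong_inverse:
  "(rev (map (\<lambda>(x, s). (x, \<not> s)) w) @ w, []) \<in> word_cong R"
proof (induction w)
  case Nil
  show ?case by (simp add: word_cong.refl)
next
  case (Cons a w)
  obtain x s where a: "a = (x, s)" by fastforce
  show ?case
    using word_cong.trans[OF word_cong.cancel[of "rev (map (\<lambda>(x, s). (x, \<not> s)) w)" x "\<not> s" w R] Cons.IH]
    by (simp add: a)
qed

lemma group_presented_group: "group (presented_group R)"
proof (rule groupI)
  fix X assume "X \<in> carrier (presented_group R)"
  then obtain u where X: "X = word_cong R `` {u}"
    by (auto simp: presented_group_def elim: quotientE)
  let ?Y = "word_cong R `` {rev (map (\<lambda>(x, s). (x, \<not> s)) u)}"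
  have "?Y \<otimes>\<^bsub>presented_group R\<^esub> X = \<one>\<^bsub>presented_group R\<^esub>"
    unfolding X presented_group_mult
    by (simp add: presented_group_def equiv_class_eq[OF equiv_word_cong word_cong_inverse])
  moreover have "?Y \<in> carrier (presented_group R)"
    by (simp add: presented_group_def quotientI)
  ultimately show "\<exists>Y\<in>carrier (presented_group R). Y \<otimes>\<^bsub>presented_group R\<^esub> X = \<one>\<^bsub>presented_group R\<^esub>"
    by blast
  have "\<one>\<^bsub>presented_group R\<^esub> = word_cong R `` {[]}"
    by (simp add: presented_group_def)
  then show "\<one>\<^bsub>presented_group R\<^esub> \<otimes>\<^bsub>presented_group R\<^esub> X = X"
    by (simp add: X presented_group_mult)
next
  fix X Y assume "X \<in> carrier (presented_group R)" "Y \<in> carrier (presented_group R)"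
  then obtain u v where XY: "X = word_cong R `` {u}" "Y = word_cong R `` {v}"
    by (auto simp: presented_group_def elim!: quotientE)
  show "X \<otimes>\<^bsub>presented_group R\<^esub> Y \<in> carrier (presented_group R)"
    unfolding XY presented_group_mult by (simp add: presented_group_def quotientI)
  fix Z assume "Z \<in> carrier (presented_group R)"
  then obtain w where Z: "Z = word_cong R `` {w}"
    by (auto simp: presented_group_def elim: quotientE)
  show "X \<otimes>\<^bsub>presented_group R\<^esub> Y \<otimes>\<^bsub>presented_group R\<^esub> Z
      = X \<otimes>\<^bsub>presented_group R\<^esub> (Y \<otimes>\<^bsub>presented_group R\<^esub> Z)"
    by (simp add: XY Z presented_group_mult)
qed (auto simp: presented_group_def intro: quotientI)


section \<open>The dihedral group\<close>

datatype dihedral_gen = Gen_a | Gen_b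

definition dihedral_relations :: "nat \<Rightarrow> (dihedral_gen group_word \<times> dihedral_gen group_word) set" where
  "dihedral_relations n =
    {(replicate n (Gen_a, True), []),
     (replicate 2 (Gen_b, True), []),
     ([(Gen_b, True), (Gen_a, True), (Gen_b, False)], [(Gen_a, False)])}"

text \<open>\<open>dihedral n\<close> is \<open>D\<^sub>2\<^sub>n\<close>, the dihedral group of order \<open>2 n\<close>.\<close>

definition dihedral :: "nat \<Rightarrow> dihedral_gen group_word set monoid" where
  "dihedral n = presented_group (dihedral_relations n)"


section \<open>The conjugacy super commuting graph\<close>

text \<open>A simple graph is represented, as in the library, by a loop-free symmetric digraph: an edge
  between \<open>g\<close> and \<open>h\<close> is the pair of arcs \<open>(g, h)\<close> and \<open>(h, g)\<close>.\<close>

definition conj_class :: "('a, 'b) monoid_scheme \<Rightarrow> 'a \<Rightarrow> 'a set" where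
  "conj_class G g = {x \<otimes>\<^bsub>G\<^esub> g \<otimes>\<^bsub>G\<^esub> inv\<^bsub>G\<^esub> x | x. x \<in> carrier G}"

definition CSCom :: "('a, 'b) monoid_scheme \<Rightarrow> 'a pair_pre_digraph" where
  "CSCom G =
    \<lparr> pverts = carrier G,
      parcs = {(g, h). g \<in> carrier G \<and> h \<in> carrier G \<and> g \<noteq> h \<and>
        (h \<in> conj_class G g \<or>
         (\<exists>g'\<in>conj_class G g. \<exists>h'\<in>conj_class G h. g' \<otimes>\<^bsub>G\<^esub> h' = h' \<otimes>\<^bsub>G\<^esub> g'))} \<rparr>"


section \<open>Complete graphs, disjoint unions and joins\<close>

definition complete_graph :: "nat \<Rightarrow> nat pair_pre_digraph" where
  "complete_graph r =
    \<lparr> pverts = {..<r}, parcs = {(u, v). u < r \<and> v < r \<and> u \<noteq> v} \<rparr>"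

lemma complete_digraph_complete_graph: "complete_digraph r (with_proj (complete_graph r))"
  by (auto simp: complete_digraph_pair_def complete_graph_def)

definition disjoint_union ::
  "'a pair_pre_digraph \<Rightarrow> 'b pair_pre_digraph \<Rightarrow> ('a + 'b) pair_pre_digraph" where
  "disjoint_union G H =
    \<lparr> pverts = pverts G <+> pverts H,
      parcs = map_prod Inl Inl ` parcs G \<union> map_prod Inr Inr ` parcs H \<rparr>"

definition copies :: "nat \<Rightarrow> 'a pair_pre_digraph \<Rightarrow> (nat \<times> 'a) pair_pre_digraph" where
  "copies m G =
    \<lparr> pverts = {..<m} \<times> pverts G,
      parcs = {((i, u), (i, v)) | i u v. i < m \<and> (u, v) \<in> parcs G} \<rparr>"

definition graph_join ::
  "'a pair_pre_digraph \<Rightarrow> 'b pair_pre_digraph \<Rightarrow> ('a + 'b) pair_pre_digraph" where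
  "graph_join G H =
    \<lparr> pverts = pverts (disjoint_union G H),
      parcs = parcs (disjoint_union G H)
        \<union> (Inl ` pverts G) \<times> (Inr ` pverts H)
        \<union> (Inr ` pverts H) \<times> (Inl ` pverts G) \<rparr>"

abbreviation graph_iso :: "'a pair_pre_digraph \<Rightarrow> 'b pair_pre_digraph \<Rightarrow> bool" where
  "graph_iso G H \<equiv> digraph_iso (with_proj G) (with_proj H)"

end

theory Submission
  imports Defs
begin

text \<open>
  Write \<open>r\<^sub>i = a\<^sup>i\<close> and \<open>s\<^sub>i = a\<^sup>i b\<close>. These are the elements of \<open>D\<^sub>2\<^sub>n\<close>, and two of them agree only
  if they are of the same kind and their exponents agree modulo \<open>n\<close> (\<open>elt_eq_iff\<close>). That no further
  collapse happens in the presented group is seen by letting words act on \<open>\<int> \<times> bool\<close> by the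
  left regular representation of the infinite dihedral group: words that are congruent under the
  relations act equally modulo \<open>n\<close> (\<open>word_cong_same_mod\<close>).

  Rotations commute with each other. The class of \<open>r\<^sub>i\<close> is \<open>{r\<^sub>i, r\<^sub>-\<^sub>i}\<close>, and \<open>r\<^sub>i\<close> commutes with a
  reflection only if \<open>n\<close> divides \<open>2 i\<close>, that is, only if \<open>r\<^sub>i\<close> is central. The class of \<open>s\<^sub>i\<close>
  consists of all \<open>s\<^sub>j\<close> with \<open>j \<equiv> i + 2 k\<close> modulo \<open>n\<close> for some \<open>k\<close>, and \<open>s\<^sub>i\<close> commutes with \<open>s\<^sub>j\<close> iff \<open>n\<close>
  divides \<open>2 (i - j)\<close>. So \<open>s\<^sub>i\<close> and \<open>s\<^sub>j\<close> are adjacent iff \<open>n\<close> divides some \<open>2 (i - j) + 4 m\<close>, which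
  fails exactly if \<open>4\<close> divides \<open>n\<close> and \<open>i - j\<close> is odd (\<open>super_commute_reflections\<close>).

  Hence the vertices split into the central rotations, the other rotations, and one or two blocks of
  reflections; distinct vertices are adjacent iff they lie in one block or one of them is central
  (\<open>super_commute_iff_label\<close>). A graph of this shape is determined by the sizes of its blocks
  (\<open>block_graph_iso\<close>), and the join in each case of the theorem has this shape, so it remains to count
  (\<open>card_label\<close>).
\<close>

section \<open>Graphs determined by a labelling of the vertices\<close>

text \<open>Vertices with label \<open>0\<close> are adjacent to all others; every other label class is a clique that
  has no further neighbours outside the vertices labelled \<open>0\<close>.\<close>

definition block_graph :: "'a set \<Rightarrow> ('a \<Rightarrow> nat) \<Rightarrow> 'a pair_pre_digraph" where
  "block_graph V f =
    \<lparr> pverts = V, parcs = {(u, v). u \<in> V \<and> v \<in> V \<and> u \<noteq> v \<and> (f u = f v \<or> f u = 0 \<or> f v = 0)} \<rparr>"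

text \<open>The library's isomorphisms carry an explicit map on arcs and new end point functions. For
  graphs whose arcs are pairs, these are induced by the map on vertices.\<close>

lemma graph_isoI:
  assumes bij: "bij_betw \<phi> (pverts G) (pverts H)"
    and G: "parcs G \<subseteq> pverts G \<times> pverts G"
    and H: "parcs H \<subseteq> pverts H \<times> pverts H"
    and arcs: "\<And>u v. u \<in> pverts G \<Longrightarrow> v \<in> pverts G \<Longrightarrow>
      (\<phi> u, \<phi> v) \<in> parcs H \<longleftrightarrow> (u, v) \<in> parcs G"
  shows "graph_iso G H"
proof -
  let ?hom = "\<lparr> iso_verts = \<phi>, iso_arcs = map_prod \<phi> \<phi>, iso_head = snd, iso_tail = fst \<rparr>"
  have inj: "inj_on \<phi> (pverts G)" and img: "\<phi> ` pverts G = pverts H"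
    using bij by (auto simp: bij_betw_def)
  have "wf_digraph (with_proj G)"
    using G by unfold_locales auto
  moreover have "inj_on (map_prod \<phi> \<phi>) (parcs G)"
    using map_prod_inj_on[OF inj inj] G by (rule inj_on_subset)
  ultimately have "pre_digraph.digraph_isomorphism (with_proj G) ?hom"
    using inj by (auto simp: pre_digraph.digraph_isomorphism_def)
  moreover have "map_prod \<phi> \<phi> ` parcs G = parcs H"
  proof (intro equalityI subsetI)
    fix e assume "e \<in> map_prod \<phi> \<phi> ` parcs G"
    then show "e \<in> parcs H" using G arcs by auto
  next
    fix e assume e: "e \<in> parcs H"
    with H img have "e \<in> (\<phi> ` pverts G) \<times> (\<phi> ` pverts G)" by auto
    then obtain u v where uv: "u \<in> pverts G" "v \<in> pverts G" "e = (\<phi> u, \<phi> v)" by auto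
    with e arcs show "e \<in> map_prod \<phi> \<phi> ` parcs G" by (auto intro!: image_eqI[of _ _ "(u, v)"])
  qed
  ultimately show ?thesis
    unfolding digraph_iso_def using img
    by (intro exI[of _ ?hom]) (simp add: app_iso_def with_proj_def)
qed

text \<open>Equally large label classes can be matched by bijections, which glue to a label-preserving
  bijection of the vertices; adjacency of distinct vertices depends on their labels alone.\<close>

lemma block_graph_iso:
  assumes fin: "finite V" "finite W"
    and card: "\<And>l. card {v \<in> V. f v = l} = card {w \<in> W. g w = l}"
  shows "graph_iso (block_graph V f) (block_graph W g)"
proof -
  have "\<exists>\<psi>. bij_betw \<psi> {v \<in> V. f v = l} {w \<in> W. g w = l}" for l
    using fin card by (intro finite_same_card_bij) auto
  then obtain \<psi> where \<psi>: "\<And>l. bij_betw (\<psi> l) {v \<in> V. f v = l} {w \<in> W. g w = l}"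
    by metis
  define \<phi> where "\<phi> v = \<psi> (f v) v" for v
  have mem: "\<phi> v \<in> W \<and> g (\<phi> v) = f v" if "v \<in> V" for v
    using bij_betwE[OF \<psi>[of "f v"]] that by (auto simp: \<phi>_def)
  have inj: "inj_on \<phi> V"
  proof (rule inj_onI)
    fix u v assume uv: "u \<in> V" "v \<in> V" "\<phi> u = \<phi> v"
    then have "f u = f v" using mem by metis
    with uv show "u = v"
      using bij_betw_imp_inj_on[OF \<psi>[of "f v"]] by (auto simp: \<phi>_def inj_on_def)
  qed
  have "W \<subseteq> \<phi> ` V"
  proof
    fix w assume "w \<in> W"
    then have "w \<in> \<psi> (g w) ` {v \<in> V. f v = g w}"
      using bij_betw_imp_surj_on[OF \<psi>[of "g w"]] by auto
    then obtain v where "v \<in> V" "f v = g w" "w = \<psi> (g w) v" by auto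
    then have "w = \<phi> v" by (simp add: \<phi>_def)
    with \<open>v \<in> V\<close> show "w \<in> \<phi> ` V" by blast
  qed
  with mem inj have "bij_betw \<phi> V W" by (auto simp: bij_betw_def)
  then show ?thesis
    using mem inj by (intro graph_isoI[of \<phi>]) (auto simp: block_graph_def inj_on_eq_iff)
qed


section \<open>Normal forms in the dihedral group\<close>

text \<open>The left regular representation of the infinite dihedral group, with \<open>(i, s)\<close> standing for
  \<open>a\<^sup>i b\<^sup>s\<close>. As \<open>b\<close> is an involution there, the letter \<open>b\<close> and its formal inverse act alike.\<close>

fun letter_action :: "dihedral_gen \<times> bool \<Rightarrow> int \<times> bool \<Rightarrow> int \<times> bool" where
  "letter_action (Gen_a, e) (i, s) = (if e then i + 1 else i - 1, s)"
| "letter_action (Gen_b, e) (i, s) = (- i, \<not> s)"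

definition word_action :: "dihedral_gen group_word \<Rightarrow> int \<times> bool \<Rightarrow> int \<times> bool" where
  "word_action w = foldr letter_action w"

definition same_mod :: "nat \<Rightarrow> int \<times> bool \<Rightarrow> int \<times> bool \<Rightarrow> bool" where
  "same_mod n p q \<longleftrightarrow> snd p = snd q \<and> int n dvd fst p - fst q"

lemma same_mod_refl: "same_mod n p p"
  by (simp add: same_mod_def)

lemma same_mod_letter_action:
  assumes "same_mod n p q" shows "same_mod n (letter_action x p) (letter_action x q)"
proof -
  obtain i s j t where pq: "p = (i, s)" "q = (j, t)" by (metis surj_pair)
  obtain g e where x: "x = (g, e)" by fastforce
  have "int n dvd j - i" if "int n dvd i - j"
    using that by (metis dvd_minus_iff minus_diff_eq)
  with assms show ?thesis by (cases g) (auto simp: pq x same_mod_def)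
qed

lemma same_mod_word_action:
  "same_mod n p q \<Longrightarrow> same_mod n (word_action w p) (word_action w q)"
  by (induction w) (auto simp: word_action_def same_mod_letter_action)

lemma word_action_append: "word_action (u @ v) p = word_action u (word_action v p)"
  by (simp add: word_action_def)

lemma word_action_Nil: "word_action [] p = p"
  by (simp add: word_action_def)

lemma word_action_b: "word_action [(Gen_b, e)] (i, s) = (- i, \<not> s)"
  by (simp add: word_action_def)

lemma word_action_replicate: "word_action (replicate k (Gen_a, True)) (i, s) = (i + int k, s)"
  by (induction k) (auto simp: word_action_def)

text \<open>Every relation becomes an identity modulo \<open>n\<close>, and the action of any prefix \<open>u\<close> preserves
  equality modulo \<open>n\<close>. This bounds the presented group from below: it keeps normal forms apart.\<close>

lemma word_cong_same_mod:
  "(u, v) \<in> word_cong (dihedral_relations n) \<Longrightarrow> same_mod n (word_action u p) (word_action v p)"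
proof (induction arbitrary: p rule: word_cong.induct)
  case (refl u)
  show ?case by (rule same_mod_refl)
next
  case (sym u v)
  then show ?case using dvd_minus_iff[of "int n"] by (metis same_mod_def minus_diff_eq)
next
  case (trans u v w)
  have "same_mod n (word_action u p) (word_action v p)" "same_mod n (word_action v p) (word_action w p)"
    using trans.IH by auto
  then have "int n dvd (fst (word_action u p) - fst (word_action v p))
      + (fst (word_action v p) - fst (word_action w p))"
    by (intro dvd_add) (simp_all add: same_mod_def)
  with \<open>same_mod n (word_action u p) (word_action v p)\<close> \<open>same_mod n (word_action v p) (word_action w p)\<close>
  show ?case by (simp add: same_mod_def)
next
  case (cancel u x s v)
  obtain i t where "word_action v p = (i, t)" by fastforce
  then show ?case
    by (cases x; cases s) (simp_all add: word_action_append word_action_def same_mod_refl)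
next
  case (rel l r u v)
  obtain i t where q: "word_action v p = (i, t)" by fastforce
  have "same_mod n (word_action l (i, t)) (word_action r (i, t))"
    using rel by (auto simp: dihedral_relations_def word_action_replicate)
      (auto simp: word_action_def same_mod_def numeral_2_eq_2)
  then show ?case by (simp add: word_action_append q same_mod_word_action)
qed

interpretation D: group "dihedral n" for n
  unfolding dihedral_def by (rule group_presented_group)

definition word_class :: "nat \<Rightarrow> dihedral_gen group_word \<Rightarrow> dihedral_gen group_word set" where
  "word_class n w = word_cong (dihedral_relations n) `` {w}"

abbreviation gena :: "nat \<Rightarrow> dihedral_gen group_word set" where
  "gena n \<equiv> word_class n [(Gen_a, True)]"

abbreviation genb :: "nat \<Rightarrow> dihedral_gen group_word set" where
  "genb n \<equiv> word_class n [(Gen_b, True)]"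

definition elt :: "nat \<Rightarrow> int \<times> bool \<Rightarrow> dihedral_gen group_word set" where
  "elt n p = gena n [^]\<^bsub>dihedral n\<^esub> fst p \<otimes>\<^bsub>dihedral n\<^esub> (if snd p then genb n else \<one>\<^bsub>dihedral n\<^esub>)"

lemma word_class_closed [simp]: "word_class n w \<in> carrier (dihedral n)"
  by (simp add: word_class_def dihedral_def presented_group_def quotientI)

lemma carrier_dihedral: "carrier (dihedral n) = range (word_class n)"
  by (auto simp: word_class_def dihedral_def presented_group_def quotient_def)

lemma word_class_append:
  "word_class n (u @ v) = word_class n u \<otimes>\<^bsub>dihedral n\<^esub> word_class n v"
  by (simp add: word_class_def dihedral_def presented_group_mult)

lemma word_class_Nil: "word_class n [] = \<one>\<^bsub>dihedral n\<^esub>"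
  by (simp add: word_class_def dihedral_def presented_group_def)

lemma word_class_eq_iff:
  "word_class n u = word_class n v \<longleftrightarrow> (u, v) \<in> word_cong (dihedral_relations n)"
  unfolding word_class_def by (rule eq_equiv_class_iff[OF equiv_word_cong]) auto

lemma word_class_relation:
  "(l, r) \<in> dihedral_relations n \<Longrightarrow> word_class n l = word_class n r"
  using word_cong.rel[of l r "dihedral_relations n" "[]" "[]"] by (simp add: word_class_eq_iff)

lemma word_class_inverse_letter:
  "word_class n [(x, False)] = inv\<^bsub>dihedral n\<^esub> (word_class n [(x, True)])"
proof -
  have "word_class n ([(x, False)] @ [(x, True)]) = word_class n []"
    using word_cong.cancel[of "[]" x False "[]"] by (simp add: word_class_eq_iff)
  then show ?thesis
    by (intro D.inv_equality[symmetric]) (simp_all add: word_class_append[symmetric] word_class_Nil)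
qed

lemma word_class_replicate:
  "word_class n (replicate k x) = word_class n [x] [^]\<^bsub>dihedral n\<^esub> k"
proof (induction k)
  case (Suc k)
  have "word_class n (replicate (Suc k) x) = word_class n (replicate k x) \<otimes>\<^bsub>dihedral n\<^esub> word_class n [x]"
    by (simp add: word_class_append[symmetric] replicate_append_same)
  then show ?case by (simp add: Suc)
qed (simp add: word_class_Nil)

lemma gena_pow_n: "gena n [^]\<^bsub>dihedral n\<^esub> n = \<one>\<^bsub>dihedral n\<^esub>"
  using word_class_relation[of "replicate n (Gen_a, True)" "[]" n]
  by (simp add: dihedral_relations_def word_class_replicate word_class_Nil)

lemma genb_square: "genb n \<otimes>\<^bsub>dihedral n\<^esub> genb n = \<one>\<^bsub>dihedral n\<^esub>"
  using word_class_relation[of "[(Gen_b, True)] @ [(Gen_b, True)]" "[]" n]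
  by (simp only: word_class_append word_class_Nil) (simp add: dihedral_relations_def numeral_2_eq_2)

lemma inv_genb: "inv\<^bsub>dihedral n\<^esub> genb n = genb n"
  by (rule D.inv_equality) (simp_all add: genb_square)

lemma genb_gena: "genb n \<otimes>\<^bsub>dihedral n\<^esub> gena n \<otimes>\<^bsub>dihedral n\<^esub> inv\<^bsub>dihedral n\<^esub> genb n
    = inv\<^bsub>dihedral n\<^esub> gena n"
proof -
  have "word_class n (([(Gen_b, True)] @ [(Gen_a, True)]) @ [(Gen_b, False)]) = word_class n [(Gen_a, False)]"
    by (rule word_class_relation) (simp add: dihedral_relations_def)
  then show ?thesis by (simp only: word_class_append word_class_inverse_letter)
qed

text \<open>Conjugation by \<open>b\<close> is a homomorphism that inverts \<open>a\<close>, so it inverts all powers of \<open>a\<close>.\<close>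

lemma genb_gena_pow:
  "genb n \<otimes>\<^bsub>dihedral n\<^esub> gena n [^]\<^bsub>dihedral n\<^esub> (i::int)
    = gena n [^]\<^bsub>dihedral n\<^esub> (- i) \<otimes>\<^bsub>dihedral n\<^esub> genb n"
proof -
  let ?G = "dihedral n"
  have hom: "(\<lambda>x. genb n \<otimes>\<^bsub>?G\<^esub> x \<otimes>\<^bsub>?G\<^esub> inv\<^bsub>?G\<^esub> genb n) \<in> hom ?G ?G"
  proof (rule homI)
    fix x y assume xy: "x \<in> carrier ?G" "y \<in> carrier ?G"
    have "inv\<^bsub>?G\<^esub> genb n \<otimes>\<^bsub>?G\<^esub> (genb n \<otimes>\<^bsub>?G\<^esub> z) = z" if "z \<in> carrier ?G" for z
      using that by (simp add: D.m_assoc[symmetric])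
    with xy show "genb n \<otimes>\<^bsub>?G\<^esub> (x \<otimes>\<^bsub>?G\<^esub> y) \<otimes>\<^bsub>?G\<^esub> inv\<^bsub>?G\<^esub> genb n =
        genb n \<otimes>\<^bsub>?G\<^esub> x \<otimes>\<^bsub>?G\<^esub> inv\<^bsub>?G\<^esub> genb n \<otimes>\<^bsub>?G\<^esub> (genb n \<otimes>\<^bsub>?G\<^esub> y \<otimes>\<^bsub>?G\<^esub> inv\<^bsub>?G\<^esub> genb n)"
      by (simp add: D.m_assoc)
  qed simp
  have "genb n \<otimes>\<^bsub>?G\<^esub> gena n [^]\<^bsub>?G\<^esub> i \<otimes>\<^bsub>?G\<^esub> inv\<^bsub>?G\<^esub> genb n = (inv\<^bsub>?G\<^esub> gena n) [^]\<^bsub>?G\<^esub> i"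
    using hom_int_pow[OF hom _ D.group_axioms D.group_axioms, of "gena n" i] by (simp add: genb_gena)
  also have "\<dots> = gena n [^]\<^bsub>?G\<^esub> (- i)"
    by (simp add: D.int_pow_inv D.int_pow_neg)
  finally show ?thesis
    by (metis D.inv_closed D.inv_solve_right' D.int_pow_closed D.m_closed word_class_closed)
qed


lemma elt_closed [simp]: "elt n p \<in> carrier (dihedral n)"
  by (simp add: elt_def)

lemma elt_mult:
  "elt n (i, s) \<otimes>\<^bsub>dihedral n\<^esub> elt n (j, t) = elt n (if s then i - j else i + j, s \<noteq> t)"
proof -
  let ?G = "dihedral n"
  let ?a = "\<lambda>i::int. gena n [^]\<^bsub>?G\<^esub> i"
  have add: "?a i \<otimes>\<^bsub>?G\<^esub> (?a j \<otimes>\<^bsub>?G\<^esub> x) = ?a (i + j) \<otimes>\<^bsub>?G\<^esub> x" if "x \<in> carrier ?G" for i j x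
    using that by (simp add: D.int_pow_mult D.m_assoc)
  have swap: "genb n \<otimes>\<^bsub>?G\<^esub> (?a j \<otimes>\<^bsub>?G\<^esub> x) = ?a (- j) \<otimes>\<^bsub>?G\<^esub> (genb n \<otimes>\<^bsub>?G\<^esub> x)"
    if "x \<in> carrier ?G" for j x
    using that genb_gena_pow[of n j] by (simp add: D.m_assoc[symmetric])
  show ?thesis
    by (cases s; cases t)
      (simp_all add: elt_def D.m_assoc add swap D.int_pow_mult genb_square genb_gena_pow
        flip: D.int_pow_mult)
qed

lemma elt_one: "elt n (0, False) = \<one>\<^bsub>dihedral n\<^esub>"
  by (simp add: elt_def)

lemma elt_inv: "inv\<^bsub>dihedral n\<^esub> elt n (i, s) = elt n (if s then i else - i, s)"
  by (rule D.inv_equality) (simp_all add: elt_mult elt_one)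

lemma elt_shift:
  assumes "int n dvd i - j" shows "elt n (i, s) = elt n (j, s)"
proof -
  obtain k where k: "i = j + int n * k"
    using assms by (metis dvdE add_diff_cancel_left' diff_add_cancel add.commute)
  have "gena n [^]\<^bsub>dihedral n\<^esub> (int n * k) = \<one>\<^bsub>dihedral n\<^esub>"
    by (simp add: D.int_pow_pow[symmetric] int_pow_int gena_pow_n)
  then show ?thesis by (simp add: elt_def k D.int_pow_mult)
qed

lemma elt_of_word: "elt n (int k, s) = word_class n (replicate k (Gen_a, True) @ (if s then [(Gen_b, True)] else []))"
  by (simp add: elt_def word_class_append word_class_replicate int_pow_int word_class_Nil)

text \<open>Replacing the exponents by their remainders turns both sides into classes of words
  \<open>a\<^sup>k b\<^sup>s\<close> with \<open>k\<close> a natural number; applied to \<open>(0, False)\<close>, such a word yields \<open>(k, s)\<close>, from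
  which its normal form can be read off.\<close>

lemma elt_eq_iff:
  assumes "n > 0"
  shows "elt n (i, s) = elt n (j, t) \<longleftrightarrow> s = t \<and> int n dvd i - j"
proof
  assume eq: "elt n (i, s) = elt n (j, t)"
  define k l where "k = nat (i mod int n)" and "l = nat (j mod int n)"
  have kl: "int n dvd i - int k" "int n dvd j - int l" "int n dvd int l - j"
    using assms by (auto simp: k_def l_def mod_eq_dvd_iff[symmetric])
  let ?w = "\<lambda>k s. replicate k (Gen_a, True) @ (if s then [(Gen_b, True)] else [])"
  have "word_class n (?w k s) = word_class n (?w l t)"
    using eq kl by (simp add: elt_of_word[symmetric] elt_shift[of n i "int k"] elt_shift[of n j "int l"])
  then have "same_mod n (word_action (?w k s) (0, False)) (word_action (?w l t) (0, False))"
    unfolding word_class_eq_iff by (rule word_cong_same_mod)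
  moreover have "word_action (?w k s) (0, False) = (int k, s)" for k s
    by (cases s) (simp_all add: word_action_append word_action_replicate word_action_Nil word_action_b)
  ultimately have "s = t" "int n dvd int k - int l"
    by (simp_all only: same_mod_def fst_conv snd_conv)
  moreover from this(2) kl have "int n dvd (i - int k) + (int k - int l) + (int l - j)"
    by (intro dvd_add)
  ultimately show "s = t \<and> int n dvd i - j" by simp
next
  assume "s = t \<and> int n dvd i - j"
  then show "elt n (i, s) = elt n (j, t)" using elt_shift by simp
qed

text \<open>Each letter is a normal form and normal forms are closed under products.\<close>

lemma word_class_in_range_elt: "word_class n w \<in> range (elt n)"
proof (induction w)
  case Nil
  show ?case by (metis word_class_Nil elt_one rangeI)
next
  case (Cons x w)
  then obtain j t where w: "word_class n w = elt n (j, t)" by auto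
  obtain g e where x: "x = (g, e)" by fastforce
  have "gena n = elt n (1, False)" "genb n = elt n (0, True)" by (simp_all add: elt_def)
  then have "word_class n [x] \<in> range (elt n)"
    by (cases g; cases e) (auto simp: x word_class_inverse_letter elt_inv)
  then obtain i s where "word_class n [x] = elt n (i, s)" by auto
  then show ?case using word_class_append[of n "[x]" w] by (simp add: w elt_mult)
qed

lemma carrier_elt: "carrier (dihedral n) = range (elt n)"
  using word_class_in_range_elt elt_closed by (fastforce simp: carrier_dihedral)

lemma bij_betw_elt:
  assumes "n > 0"
  shows "bij_betw (elt n) ({0..<int n} \<times> UNIV) (carrier (dihedral n))"
proof (rule bij_betw_imageI)
  show "inj_on (elt n) ({0..<int n} \<times> UNIV)"
    using assms by (auto simp: inj_on_def elt_eq_iff mod_eq_dvd_iff[symmetric])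
  show "elt n ` ({0..<int n} \<times> UNIV) = carrier (dihedral n)"
  proof (intro equalityI subsetI)
    fix x assume "x \<in> carrier (dihedral n)"
    then obtain i s where "x = elt n (i, s)" by (auto simp: carrier_elt)
    then have "x = elt n (i mod int n, s)"
      using assms by (simp add: elt_eq_iff mod_eq_dvd_iff[symmetric])
    with assms show "x \<in> elt n ` ({0..<int n} \<times> UNIV)" by auto
  qed auto
qed


section \<open>Conjugacy and commutation\<close>

lemma conj_class_dihedral:
  "conj_class (dihedral n) g =
    range (\<lambda>q. elt n q \<otimes>\<^bsub>dihedral n\<^esub> g \<otimes>\<^bsub>dihedral n\<^esub> inv\<^bsub>dihedral n\<^esub> elt n q)"
  by (auto simp: conj_class_def carrier_elt)

lemma conj_class_rotation:
  "conj_class (dihedral n) (elt n (i, False)) = {elt n (i, False), elt n (- i, False)}"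
proof -
  have "elt n (k, u) \<otimes>\<^bsub>dihedral n\<^esub> elt n (i, False) \<otimes>\<^bsub>dihedral n\<^esub> inv\<^bsub>dihedral n\<^esub> elt n (k, u)
      = elt n (if u then - i else i, False)" for k u
    by (simp add: elt_mult elt_inv)
  then have "conj_class (dihedral n) (elt n (i, False)) =
      range (\<lambda>(k :: int, u). elt n (if u then - i else i, False))"
    unfolding conj_class_dihedral by (intro image_cong) auto
  also have "\<dots> = {elt n (i, False), elt n (- i, False)}"
    by (auto simp: image_def)
  finally show ?thesis .
qed

lemma conj_class_reflection:
  "conj_class (dihedral n) (elt n (i, True)) = range (\<lambda>k. elt n (i + 2 * k, True))"
proof -
  have "elt n (k, u) \<otimes>\<^bsub>dihedral n\<^esub> elt n (i, True) \<otimes>\<^bsub>dihedral n\<^esub> inv\<^bsub>dihedral n\<^esub> elt n (k, u)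
      = elt n (i + 2 * (if u then k - i else k), True)" for k u
    by (simp add: elt_mult elt_inv algebra_simps)
  then have "conj_class (dihedral n) (elt n (i, True)) =
      range (\<lambda>(k, u). elt n (i + 2 * (if u then k - i else k), True))"
    unfolding conj_class_dihedral by (intro image_cong) (auto simp del: if_split)
  also have "\<dots> = range (\<lambda>k. elt n (i + 2 * k, True))"
    by (auto simp del: if_split intro: rev_image_eqI[of "(_, False)"])
  finally show ?thesis .
qed

text \<open>Label \<open>0\<close> marks the central rotations, \<open>1\<close> the remaining rotations, \<open>2\<close> and \<open>3\<close> the
  reflections. The two conjugacy classes of reflections that exist for even \<open>n\<close> get different
  labels only if \<open>4\<close> divides \<open>n\<close>: otherwise \<open>b\<close> commutes with \<open>a\<^sup>n\<^sup>/\<^sup>2 b\<close>, which lies in the class that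
  does not contain \<open>b\<close>. For \<open>4 dvd n\<close> the parity of an exponent is well defined modulo \<open>n\<close>.\<close>

definition label :: "nat \<Rightarrow> int \<times> bool \<Rightarrow> nat" where
  "label n p = (if snd p then (if 4 dvd n \<and> odd (fst p) then 3 else 2)
     else (if int n dvd 2 * fst p then 0 else 1))"

text \<open>The adjacency condition of the graph, without distinctness, read on exponents.\<close>

definition super_commute :: "nat \<Rightarrow> int \<times> bool \<Rightarrow> int \<times> bool \<Rightarrow> bool" where
  "super_commute n p q \<longleftrightarrow> elt n q \<in> conj_class (dihedral n) (elt n p) \<or>
    (\<exists>g\<in>conj_class (dihedral n) (elt n p). \<exists>h\<in>conj_class (dihedral n) (elt n q).
      g \<otimes>\<^bsub>dihedral n\<^esub> h = h \<otimes>\<^bsub>dihedral n\<^esub> g)"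

lemma super_commute_rotations: "super_commute n (i, False) (j, False)"
  by (simp add: super_commute_def conj_class_rotation elt_mult add.commute)

text \<open>A rotation and a reflection are never conjugate, and conjugating a rotation at most inverts
  it, so only the centrality of the rotation matters.\<close>

lemma super_commute_rotation_reflection:
  assumes "n > 0"
  shows "super_commute n (i, False) (j, True) \<longleftrightarrow> int n dvd 2 * i"
    and "super_commute n (j, True) (i, False) \<longleftrightarrow> int n dvd 2 * i"
proof -
  have "int n dvd - (2 * i) \<longleftrightarrow> int n dvd 2 * i" by simp
  then show "super_commute n (i, False) (j, True) \<longleftrightarrow> int n dvd 2 * i"
    "super_commute n (j, True) (i, False) \<longleftrightarrow> int n dvd 2 * i"
    using assms by (auto simp: super_commute_def conj_class_rotation conj_class_reflection elt_mult elt_eq_iff)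
qed

text \<open>The subgroup of the integers generated by \<open>n\<close> and \<open>4\<close> is that of the multiples of
  \<open>gcd n 4\<close>; it contains \<open>2 d\<close> for every \<open>d\<close> unless this gcd is \<open>4\<close>.\<close>

lemma ex_dvd_plus_4_iff:
  fixes d :: int
  shows "(\<exists>m. int n dvd 2 * d + 4 * m) \<longleftrightarrow> (4 dvd n \<longrightarrow> even d)"
proof (cases "4 dvd n")
  case True
  then obtain c where "n = 4 * c" by blast
  then have "even d" if dvd: "int n dvd 2 * d + 4 * m" for m
  proof -
    from dvd \<open>n = 4 * c\<close> have "4 dvd 2 * d + 4 * m" by (metis dvd_trans dvd_triv_left of_nat_mult of_nat_numeral)
    then show ?thesis by presburger
  qed
  moreover have "\<exists>m. int n dvd 2 * d + 4 * m" if "even d"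
    using that by (auto elim!: evenE intro!: exI[of _ "- (d div 2)"])
  ultimately show ?thesis using True by blast
next
  case False
  have "\<exists>m. int n dvd 2 * d + 4 * m"
  proof (cases "even n")
    case True
    with False have "n mod 4 = 2" by presburger
    then have "int n = 2 + 4 * int (n div 4)" by presburger
    then have "2 * d + 4 * (int (n div 4) * d) = int n * d" by (simp add: algebra_simps)
    then show ?thesis by (metis dvd_triv_left)
  next
    case False
    then have "int n = 1 + 2 * int (n div 2)" by presburger
    then have "2 * d + 4 * (int (n div 2) * d) = int n * (2 * d)" by (simp add: algebra_simps)
    then show ?thesis by (metis dvd_triv_left)
  qed
  with False show ?thesis by blast
qed

text \<open>Conjugate reflections satisfy the condition for commuting representatives as well, so both
  kinds of adjacency merge into one divisibility condition: shifting the exponents \<open>i\<close> and \<open>j\<close> by even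
  numbers changes \<open>2 (i - j)\<close> by arbitrary multiples of \<open>4\<close>.\<close>

lemma super_commute_reflections:
  assumes "n > 0"
  shows "super_commute n (i, True) (j, True) \<longleftrightarrow> (4 dvd n \<longrightarrow> even (i - j))"
proof -
  have conj: "elt n (j, True) \<in> conj_class (dihedral n) (elt n (i, True)) \<longleftrightarrow>
      (\<exists>k. int n dvd j - (i + 2 * k))"
    using assms by (auto simp: conj_class_reflection elt_eq_iff)
  have comm: "elt n (i', True) \<otimes>\<^bsub>dihedral n\<^esub> elt n (j', True) = elt n (j', True) \<otimes>\<^bsub>dihedral n\<^esub> elt n (i', True)
      \<longleftrightarrow> int n dvd 2 * (i' - j')" for i' j'
    using assms by (simp add: elt_mult elt_eq_iff algebra_simps)
  have "super_commute n (i, True) (j, True) \<longleftrightarrow>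
      (\<exists>k. int n dvd j - (i + 2 * k)) \<or> (\<exists>k l. int n dvd 2 * ((i + 2 * k) - (j + 2 * l)))"
    unfolding super_commute_def conj by (simp add: conj_class_reflection comm)
  also have "\<dots> \<longleftrightarrow> (\<exists>m. int n dvd 2 * (i - j) + 4 * m)"
  proof (intro iffI; elim disjE exE)
    fix k assume "int n dvd j - (i + 2 * k)"
    \<comment> \<open>The factor \<open>-2\<close> turns \<open>j - i - 2 k\<close> into \<open>2 (i - j) + 4 k\<close>.\<close>
    then have "int n dvd (j - (i + 2 * k)) * (-2)" by (rule dvd_mult2)
    then show "\<exists>m. int n dvd 2 * (i - j) + 4 * m"
      by (intro exI[of _ k]) (simp add: algebra_simps)
  next
    fix k l assume "int n dvd 2 * ((i + 2 * k) - (j + 2 * l))"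
    then show "\<exists>m. int n dvd 2 * (i - j) + 4 * m"
      by (intro exI[of _ "k - l"]) (simp add: algebra_simps)
  next
    fix m assume "int n dvd 2 * (i - j) + 4 * m"
    then have "int n dvd 2 * ((i + 2 * m) - (j + 2 * 0))" by (simp add: algebra_simps)
    then show "(\<exists>k. int n dvd j - (i + 2 * k)) \<or> (\<exists>k l. int n dvd 2 * ((i + 2 * k) - (j + 2 * l)))"
      by blast
  qed
  finally show ?thesis by (simp only: ex_dvd_plus_4_iff)
qed

lemma super_commute_iff_label:
  assumes "n > 0"
  shows "super_commute n p q \<longleftrightarrow> label n p = label n q \<or> label n p = 0 \<or> label n q = 0"
proof -
  obtain i s j t where pq: "p = (i, s)" "q = (j, t)" by (metis surj_pair)
  show ?thesis
    using assms
    by (cases s; cases t)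
      (auto simp: pq label_def super_commute_rotations super_commute_rotation_reflection
        super_commute_reflections)
qed

lemma CSCom_dihedral_iso_block_graph:
  assumes "n > 0"
  shows "graph_iso (CSCom (dihedral n)) (block_graph ({0..<int n} \<times> UNIV) (label n))"
proof (rule digraph_iso_swap)
  show "wf_digraph (with_proj (block_graph ({0..<int n} \<times> UNIV) (label n)))"
    by unfold_locales (auto simp: block_graph_def)
  have inj: "elt n p = elt n q \<longleftrightarrow> p = q" if "p \<in> {0..<int n} \<times> UNIV" "q \<in> {0..<int n} \<times> UNIV" for p q
    using bij_betw_imp_inj_on[OF bij_betw_elt[OF assms]] that by (rule inj_on_eq_iff)
  show "graph_iso (block_graph ({0..<int n} \<times> UNIV) (label n)) (CSCom (dihedral n))"
  proof (rule graph_isoI)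
    show "bij_betw (elt n) (pverts (block_graph ({0..<int n} \<times> UNIV) (label n))) (pverts (CSCom (dihedral n)))"
      using bij_betw_elt[OF assms] by (simp add: block_graph_def CSCom_def)
  next
    fix p q
    assume "p \<in> pverts (block_graph ({0..<int n} \<times> UNIV) (label n))"
      "q \<in> pverts (block_graph ({0..<int n} \<times> UNIV) (label n))"
    then have pq: "p \<in> {0..<int n} \<times> UNIV" "q \<in> {0..<int n} \<times> UNIV"
      by (simp_all add: block_graph_def)
    have "(elt n p, elt n q) \<in> parcs (CSCom (dihedral n)) \<longleftrightarrow> p \<noteq> q \<and> super_commute n p q"
      using inj[OF pq] by (simp add: CSCom_def super_commute_def)
    also have "\<dots> \<longleftrightarrow> (p, q) \<in> parcs (block_graph ({0..<int n} \<times> UNIV) (label n))"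
      using pq by (simp add: block_graph_def super_commute_iff_label[OF assms])
    finally show "(elt n p, elt n q) \<in> parcs (CSCom (dihedral n)) \<longleftrightarrow>
      (p, q) \<in> parcs (block_graph ({0..<int n} \<times> UNIV) (label n))" .
  qed (auto simp: block_graph_def CSCom_def)
qed


section \<open>Sizes of the blocks\<close>

lemma mem_map_prod_image: "(x, y) \<in> map_prod f g ` S \<longleftrightarrow> (\<exists>a b. (a, b) \<in> S \<and> x = f a \<and> y = g b)"
  by force

lemma join_complete_disjoint_union:
  "graph_join (complete_graph c) (disjoint_union (complete_graph r) (complete_graph m)) =
    block_graph ({..<c} <+> ({..<r} <+> {..<m})) (case_sum (\<lambda>_. 0) (case_sum (\<lambda>_. 1) (\<lambda>_. 2)))"
  by (auto simp: graph_join_def disjoint_union_def complete_graph_def block_graph_def)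

lemma join_complete_disjoint_union_copies:
  "graph_join (complete_graph c) (disjoint_union (complete_graph r) (copies 2 (complete_graph m))) =
    block_graph ({..<c} <+> ({..<r} <+> ({..<2} \<times> {..<m})))
      (case_sum (\<lambda>_. 0) (case_sum (\<lambda>_. 1) (\<lambda>(i, _). 2 + i)))"
  by (auto simp: graph_join_def disjoint_union_def complete_graph_def block_graph_def copies_def mem_map_prod_image)

lemma card_fibre_Plus:
  assumes "finite A" "finite B"
  shows "card {v \<in> A <+> B. case_sum f g v = l} = card {a \<in> A. f a = l} + card {b \<in> B. g b = l}"
proof -
  have "{v \<in> A <+> B. case_sum f g v = l} = {a \<in> A. f a = l} <+> {b \<in> B. g b = l}"
    by auto
  then show ?thesis using assms by (simp add: card_Plus)
qed

lemma card_fibre_const: "card {a \<in> A. c = l} = (if c = l then card A else 0)"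
  by auto

lemma card_block_join:
  "card {v \<in> {..<c} <+> ({..<r} <+> {..<m}). case_sum (\<lambda>_. 0) (case_sum (\<lambda>_. 1) (\<lambda>_. 2)) v = (l :: nat)} =
    (if l = 0 then c else if l = 1 then r else if l = 2 then m else 0)"
  by (simp only: card_fibre_Plus card_fibre_const finite_Plus finite_lessThan) auto

lemma card_block_join_copies:
  "card {v \<in> {..<c} <+> ({..<r} <+> ({..<2} \<times> {..<m})).
      case_sum (\<lambda>_. 0) (case_sum (\<lambda>_. 1) (\<lambda>(i, _). 2 + i)) v = (l :: nat)} =
    (if l = 0 then c else if l = 1 then r else if l = 2 \<or> l = 3 then m else 0)"
proof -
  have "{p \<in> {..<2} \<times> {..<m}. (case p of (i, _) \<Rightarrow> 2 + i) = (l :: nat)} =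
      (if l = 2 then {0} else if l = 3 then {1} else {}) \<times> {..<m}"
    by (auto split: if_splits)
  then have "card {p \<in> {..<2} \<times> {..<m}. (case p of (i, _) \<Rightarrow> 2 + i) = (l :: nat)} =
      (if l = 2 \<or> l = 3 then m else 0)"
    by (simp add: card_cartesian_product)
  then show ?thesis
    by (simp only: card_fibre_Plus card_fibre_const finite_Plus finite_lessThan
        finite_cartesian_product) auto
qed

text \<open>The exponents \<open>i\<close> for which \<open>a\<^sup>i\<close> commutes with \<open>b\<close>.\<close>

definition centre_exponents :: "nat \<Rightarrow> int set" where
  "centre_exponents n = {i \<in> {0..<int n}. int n dvd 2 * i}"

text \<open>For \<open>0 \<le> i < n\<close> the only multiples of \<open>n\<close> that \<open>2 i\<close> can equal are \<open>0\<close> and \<open>n\<close>.\<close>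

lemma centre_exponents_eq:
  assumes "n > 0"
  shows "centre_exponents n = (if even n then {0, int (n div 2)} else {0})"
proof -
  have solution: "i = 0 \<or> 2 * i = int n" if "int n dvd 2 * i" "0 \<le> i" "i < int n" for i
  proof -
    obtain k where k: "2 * i = int n * k" using \<open>int n dvd 2 * i\<close> by blast
    with that assms have "int n * k < int n * 2" "int n * 0 \<le> int n * k" by linarith+
    with assms have "0 \<le> k" "k < 2" by (simp_all only: mult_less_cancel_left mult_le_cancel_left)
    then have "k = 0 \<or> k = 1" by linarith
    with k show ?thesis by auto
  qed
  show ?thesis
  proof (intro equalityI subsetI)
    fix i assume "i \<in> centre_exponents n"
    then have "i = 0 \<or> 2 * i = int n" using solution by (auto simp: centre_exponents_def)
    then show "i \<in> (if even n then {0, int (n div 2)} else {0})" by simp presburger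
  next
    fix i assume i: "i \<in> (if even n then {0, int (n div 2)} else {0})"
    then have "i = 0 \<or> 2 * i = int n" by (auto split: if_splits)
    with assms show "i \<in> centre_exponents n" by (auto simp: centre_exponents_def)
  qed
qed

lemma card_parity_exponents:
  assumes "even n"
  shows "card {i \<in> {0..<int n}. even i} = n div 2" "card {i \<in> {0..<int n}. odd i} = n div 2"
proof -
  have "bij_betw (\<lambda>k. 2 * int k) {..<n div 2} {i \<in> {0..<int n}. even i}"
    using assms by (intro bij_betwI[of _ _ _ "\<lambda>i. nat (i div 2)"]) auto
  from bij_betw_same_card[OF this] show "card {i \<in> {0..<int n}. even i} = n div 2" by simp
  have "bij_betw (\<lambda>k. 2 * int k + 1) {..<n div 2} {i \<in> {0..<int n}. odd i}"
    using assms by (intro bij_betwI[of _ _ _ "\<lambda>i. nat (i div 2)"]) auto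
  from bij_betw_same_card[OF this] show "card {i \<in> {0..<int n}. odd i} = n div 2" by simp
qed

text \<open>The rotations split into the central ones and the others; the reflections form a single block
  unless \<open>4\<close> divides \<open>n\<close>, when the parity of the exponent halves them.\<close>

lemma card_label:
  assumes "n > 0"
  shows "card {p \<in> {0..<int n} \<times> UNIV. label n p = l} =
    (if l = 0 then (if even n then 2 else 1)
     else if l = 1 then (if even n then n - 2 else n - 1)
     else if l = 2 then (if 4 dvd n then n div 2 else n)
     else if l = 3 then (if 4 dvd n then n div 2 else 0) else 0)"
proof -
  have card: "card (A \<times> {s :: bool}) = card A" for A :: "int set" and s
    by (simp add: card_cartesian_product)
  have c: "card (centre_exponents n) = (if even n then 2 else 1)"
    using assms by (auto simp: centre_exponents_eq elim!: evenE)
  have sub: "centre_exponents n \<subseteq> {0..<int n}" by (auto simp: centre_exponents_def)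
  consider "l = 0" | "l = 1" | "l = 2" | "l = 3" | "l > 3" by linarith
  then show ?thesis
  proof cases
    case 1
    then have "{p \<in> {0..<int n} \<times> UNIV. label n p = l} = centre_exponents n \<times> {False}"
      by (auto simp: label_def centre_exponents_def split: if_splits)
    with 1 c show ?thesis by (simp add: card)
  next
    case 2
    then have "{p \<in> {0..<int n} \<times> UNIV. label n p = l} = ({0..<int n} - centre_exponents n) \<times> {False}"
      by (auto simp: label_def centre_exponents_def split: if_splits)
    with 2 c sub show ?thesis by (simp add: card card_Diff_subset finite_subset)
  next
    case 3
    then have "{p \<in> {0..<int n} \<times> UNIV. label n p = l} =
        (if 4 dvd n then {i \<in> {0..<int n}. even i} else {0..<int n}) \<times> {True}"
      by (auto simp: label_def split: if_splits)
    moreover have "even n" if "4 dvd n" using that by presburger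
    ultimately show ?thesis using 3 card_parity_exponents[of n] by (simp add: card)
  next
    case 4
    then have "{p \<in> {0..<int n} \<times> UNIV. label n p = l} =
        (if 4 dvd n then {i \<in> {0..<int n}. odd i} else {}) \<times> {True}"
      by (auto simp: label_def split: if_splits)
    moreover have "even n" if "4 dvd n" using that by presburger
    ultimately show ?thesis using 4 card_parity_exponents[of n] by (simp add: card)
  next
    case 5
    then have "{p \<in> {0..<int n} \<times> UNIV. label n p = l} = {}"
      by (auto simp: label_def split: if_splits)
    then have "card {p \<in> {0..<int n} \<times> UNIV. label n p = l} = 0" by (simp only: card.empty)
    with 5 show ?thesis by simp
  qed
qed


theorem theorem2p3:
  fixes n :: nat
  assumes "n \<ge> 3"
  shows "(odd n \<longrightarrow>
            graph_iso (CSCom (dihedral n))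
              (graph_join (complete_graph 1)
                (disjoint_union (complete_graph (n - 1)) (complete_graph n)))) \<and>
         (even n \<and> even (n div 2) \<longrightarrow>
            graph_iso (CSCom (dihedral n))
              (graph_join (complete_graph 2)
                (disjoint_union (complete_graph (n - 2)) (copies 2 (complete_graph (n div 2)))))) \<and>
         (even n \<and> odd (n div 2) \<longrightarrow>
            graph_iso (CSCom (dihedral n))
              (graph_join (complete_graph 2)
                (disjoint_union (complete_graph (n - 2)) (complete_graph n))))"
proof (intro conjI impI)
  have n: "n > 0" using assms by simp
  note iso = digraph_iso_trans[OF CSCom_dihedral_iso_block_graph[OF n]]
  show "graph_iso (CSCom (dihedral n))
      (graph_join (complete_graph 1) (disjoint_union (complete_graph (n - 1)) (complete_graph n)))"
    if "odd n"
  proof -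
    from that have "\<not> 4 dvd n" by presburger
    with that show ?thesis unfolding join_complete_disjoint_union
      by (intro iso block_graph_iso) (simp_all only: card_label[OF n] card_block_join, auto)
  qed
  show "graph_iso (CSCom (dihedral n))
      (graph_join (complete_graph 2)
        (disjoint_union (complete_graph (n - 2)) (copies 2 (complete_graph (n div 2)))))"
    if "even n \<and> even (n div 2)"
  proof -
    from that have "4 dvd n" by presburger
    with that show ?thesis unfolding join_complete_disjoint_union_copies
      by (intro iso block_graph_iso) (simp_all only: card_label[OF n] card_block_join_copies, auto)
  qed
  show "graph_iso (CSCom (dihedral n))
      (graph_join (complete_graph 2) (disjoint_union (complete_graph (n - 2)) (complete_graph n)))"
    if "even n \<and> odd (n div 2)"
  proof -
    from that have "\<not> 4 dvd n" by presburger
    with that show ?thesis unfolding join_complete_disjoint_union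
      by (intro iso block_graph_iso) (simp_all only: card_label[OF n] card_block_join, auto)
  qed
qed

end
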